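(* Let $G=(V,E)$ be a finite graph. For a partition of $E$ into three sets $X,Y,Z$ (not all of which need be non-empty), choose $A\subseteq X$, $B\subseteq Y$ and $C\subseteq Z$ independently and uniformly at random, let $\Sigma$ be the event that $|A|+|B|+|C|\equiv 0\pmod 2$, and let $\Gamma$ be the event that $A\cup C$ and $C\cup B$ are both eulerian. Then $\mathrm{Bias}(\Sigma\mid\Gamma)\neq 0$ for some such tripartition $\{X,Y,Z\}$ of $E$ if and only if $P(G;4)\neq 0$.
   Context: Graphs are finite; loops and parallel edges are permitted. A subset $A\subseteq E$ is identified with the subgraph $(V,A)$ of $G$; it is called eulerian if all its vertex degrees are even (a loop contributes 2 to the degree). $P(G;q)$ is the number of proper vertex $q$-colourings of $G$. $\mathrm{Bias}(\Sigma\mid\Gamma)=\mathbb{P}(\Sigma\mid\Gamma)-\mathbb{P}(\overline{\Sigma}\mid\Gamma)$, where $\overline{\Sigma}$ is the complement of $\Sigma$. *)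

theory Defs
  imports "HOL-Probability.Probability"
begin

text \<open>
  Undirected graphs with loops and parallel edges. The ends of an edge form a multiset of
  size two, so that a loop at \<open>v\<close> has ends \<open>{#v, v#}\<close>.
\<close>

record ('v, 'e) multigraph =
  verts :: "'v set"
  edges :: "'e set"
  ends :: "'e \<Rightarrow> 'v multiset"

locale finite_multigraph =
  fixes G :: "('v, 'e) multigraph"
  assumes finite_verts: "finite (verts G)"
    and finite_edges: "finite (edges G)"
    and size_ends: "e \<in> edges G \<Longrightarrow> size (ends G e) = 2"
    and ends_subset_verts: "e \<in> edges G \<Longrightarrow> set_mset (ends G e) \<subseteq> verts G"

definition spanning_subgraph :: "('v, 'e) multigraph \<Rightarrow> 'e set \<Rightarrow> ('v, 'e) multigraph" where
  "spanning_subgraph G A = G\<lparr>edges := A\<rparr>"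

text \<open>The multiplicity in the multiset of ends makes a loop contribute 2.\<close>

definition degree :: "('v, 'e) multigraph \<Rightarrow> 'v \<Rightarrow> nat" where
  "degree G v = (\<Sum>e\<in>edges G. count (ends G e) v)"

definition eulerian :: "('v, 'e) multigraph \<Rightarrow> bool" where
  "eulerian G \<longleftrightarrow> (\<forall>v\<in>verts G. even (degree G v))"

definition proper_colouring :: "('v, 'e) multigraph \<Rightarrow> ('v \<Rightarrow> nat) \<Rightarrow> bool" where
  "proper_colouring G f \<longleftrightarrow> (\<forall>e\<in>edges G. \<forall>u v. ends G e = {#u, v#} \<longrightarrow> f u \<noteq> f v)"

definition num_colourings :: "('v, 'e) multigraph \<Rightarrow> nat \<Rightarrow> nat" where
  "num_colourings G q = card {f \<in> verts G \<rightarrow>\<^sub>E {..<q}. proper_colouring G f}"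

definition tripartition :: "'e set \<Rightarrow> 'e set \<Rightarrow> 'e set \<Rightarrow> 'e set \<Rightarrow> bool" where
  "tripartition E X Y Z \<longleftrightarrow>
     X \<union> Y \<union> Z = E \<and> X \<inter> Y = {} \<and> X \<inter> Z = {} \<and> Y \<inter> Z = {}"

definition bias :: "'a measure \<Rightarrow> ('a \<Rightarrow> bool) \<Rightarrow> ('a \<Rightarrow> bool) \<Rightarrow> real" where
  "bias M S T = cond_prob M S T - cond_prob M (\<lambda>x. \<not> S x) T"

definition random_subsets :: "'e set \<Rightarrow> 'e set \<Rightarrow> 'e set \<Rightarrow> ('e set \<times> 'e set \<times> 'e set) pmf" where
  "random_subsets X Y Z =
     pair_pmf (pmf_of_set (Pow X)) (pair_pmf (pmf_of_set (Pow Y)) (pmf_of_set (Pow Z)))"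

end

theory Submission
  imports Defs
begin

text \<open>
  This is Fourier analysis over the cuts: the indicator that
  \<open>U\<close> is eulerian is the average over \<open>S \<subseteq> V\<close> of \<open>\<Prod>e\<in>U. s e\<close>, where \<open>s e = -1\<close> if \<open>e\<close> lies in the
  cut of \<open>S\<close> and \<open>s e = 1\<close> otherwise. The bias is therefore a positive multiple of
  \<open>\<Sum>S T. (\<Prod>e\<in>X. 1 - s e) (\<Prod>e\<in>Y. 1 - t e) (\<Prod>e\<in>Z. 1 - s e t e)\<close>, whose terms are
  nonnegative. A nonzero term provides two cuts covering \<open>E\<close>, that is, a proper 4-colouring, and
  conversely two such cuts yield a tripartition with \<open>Z\<close> empty.
\<close>

section \<open>Signs of cuts and the eulerian indicator\<close>

text \<open>The exponent counts the ends of \<open>e\<close> in \<open>S\<close> with multiplicity,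
  so a loop always gets sign 1. As a power of -1, the sign turns products over edges into sums of
  degrees.\<close>

definition cut_sign :: "('v, 'e) multigraph \<Rightarrow> 'v set \<Rightarrow> 'e \<Rightarrow> real" where
  "cut_sign G S e = (- 1) ^ (\<Sum>v\<in>S. count (ends G e) v)"

lemma cut_sign_cases: "cut_sign G S e = 1 \<or> cut_sign G S e = - 1"
  unfolding cut_sign_def using neg_one_even_power neg_one_odd_power by blast

text \<open>The exponent is the number of ends in \<open>S\<close>, which is 0, 1 or 2. Finiteness
  of \<open>S\<close> matters because a sum over an infinite set is 0 by convention.\<close>

lemma cut_sign_eq_minus_one_iff:
  assumes "finite S" "ends G e = {#u, v#}"
  shows "cut_sign G S e = - 1 \<longleftrightarrow> (u \<in> S) \<noteq> (v \<in> S)"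
proof -
  have "(\<Sum>x\<in>S. count (ends G e) x) = (\<Sum>x\<in>S. (if x = u then 1 else 0) + (if x = v then 1 else 0))"
    by (rule sum.cong) (auto simp: assms)
  also have "\<dots> = (if u \<in> S then 1 else 0) + (if v \<in> S then 1 else 0)"
    using assms by (simp add: sum.distrib)
  finally show ?thesis
    by (simp add: cut_sign_def)
qed

lemma sum_Pow_prod:
  fixes f :: "'a \<Rightarrow> 'b::comm_semiring_1"
  assumes "finite A"
  shows "(\<Sum>B\<in>Pow A. \<Prod>x\<in>B. f x) = (\<Prod>x\<in>A. 1 + f x)"
  using prod_add[OF assms, of f "\<lambda>_. 1"] by (simp add: add.commute)

text \<open>Double counting the incidences between \<open>U\<close> and \<open>S\<close> gives -1 to
  the power of the degree for each vertex of \<open>S\<close>. The sum over \<open>S\<close> then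
  factors over the vertices into terms 2 or 0, so a single vertex of odd degree annihilates
  it.\<close>

lemma sum_cut_sign_prod:
  assumes "finite (verts G)"
  shows "(\<Sum>S\<in>Pow (verts G). \<Prod>e\<in>U. cut_sign G S e) =
    (if eulerian (spanning_subgraph G U) then 2 ^ card (verts G) else 0)"
proof -
  let ?d = "degree (spanning_subgraph G U)"
  have "(\<Prod>e\<in>U. cut_sign G S e) = (\<Prod>v\<in>S. (- 1) ^ ?d v)" for S
  proof -
    have "(\<Prod>e\<in>U. cut_sign G S e) = (- 1) ^ (\<Sum>e\<in>U. \<Sum>v\<in>S. count (ends G e) v)"
      by (simp add: cut_sign_def power_sum)
    also have "(\<Sum>e\<in>U. \<Sum>v\<in>S. count (ends G e) v) = (\<Sum>v\<in>S. ?d v)"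
      unfolding degree_def spanning_subgraph_def by (subst sum.swap) simp
    finally show ?thesis
      by (simp add: power_sum)
  qed
  then have *: "(\<Sum>S\<in>Pow (verts G). \<Prod>e\<in>U. cut_sign G S e) = (\<Prod>v\<in>verts G. 1 + (- 1) ^ ?d v)"
    using sum_Pow_prod[OF assms] by simp
  show ?thesis
  proof (cases "eulerian (spanning_subgraph G U)")
    case True
    then have "even (?d v)" if "v \<in> verts G" for v
      using that by (auto simp: eulerian_def spanning_subgraph_def)
    then have "(\<Prod>v\<in>verts G. 1 + (- 1) ^ ?d v) = (\<Prod>v\<in>verts G. 2::real)"
      by (intro prod.cong) auto
    with True * show ?thesis
      by simp
  next
    case False
    then obtain v where "v \<in> verts G" "odd (?d v)"
      by (auto simp: eulerian_def spanning_subgraph_def)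
    then have "(\<Prod>v\<in>verts G. 1 + (- 1) ^ ?d v) = (0::real)"
      using assms by (intro prod_zero bexI[of _ v]) auto
    with False * show ?thesis
      by simp
  qed
qed

section \<open>The bias as a sum over pairs of cuts\<close>

text \<open>The size of \<open>\<Omega>\<close> cancels in both conditional probabilities. If
  \<open>T\<close> never holds, both sides are 0 by the convention on division.\<close>

lemma bias_pmf_of_set:
  assumes "finite \<Omega>" "\<Omega> \<noteq> {}"
  shows "bias (measure_pmf (pmf_of_set \<Omega>)) S T =
    (\<Sum>\<omega>\<in>\<Omega>. if T \<omega> then (if S \<omega> then 1 else - 1) else 0) / card {\<omega>\<in>\<Omega>. T \<omega>}"
proof -
  have m: "measure (measure_pmf (pmf_of_set \<Omega>)) {\<omega>. P \<omega>} = card {\<omega>\<in>\<Omega>. P \<omega>} / card \<Omega>" for P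
    using assms by (simp add: measure_pmf_of_set Collect_conj_eq)
  have "real (card {\<omega>\<in>\<Omega>. S \<omega> \<and> T \<omega>}) - card {\<omega>\<in>\<Omega>. \<not> S \<omega> \<and> T \<omega>} =
      (\<Sum>\<omega>\<in>\<Omega>. (if S \<omega> \<and> T \<omega> then 1 else 0) - (if \<not> S \<omega> \<and> T \<omega> then 1 else 0))"
    using assms by (simp add: sum_subtractf sum.If_cases Int_def)
  also have "\<dots> = (\<Sum>\<omega>\<in>\<Omega>. if T \<omega> then (if S \<omega> then 1 else - 1) else 0)"
    by (intro sum.cong) auto
  finally show ?thesis
    using assms by (simp add: bias_def cond_prob_def m flip: diff_divide_distrib)
qed

lemma random_subsets_eq_pmf_of_set:
  assumes "finite X" "finite Y" "finite Z"
  shows "random_subsets X Y Z = pmf_of_set (Pow X \<times> Pow Y \<times> Pow Z)"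
proof -
  have *: "pmf (pmf_of_set (Pow A)) B = indicator (Pow A) B / card (Pow A)"
    if "finite A" for A B :: "'a set"
    using that by (intro pmf_of_set) auto
  have "pmf (pmf_of_set (Pow X \<times> Pow Y \<times> Pow Z)) \<omega> =
      indicator (Pow X \<times> Pow Y \<times> Pow Z) \<omega> / card (Pow X \<times> Pow Y \<times> Pow Z)" for \<omega>
    using assms by (intro pmf_of_set) auto
  then show ?thesis
    using assms unfolding random_subsets_def
    by (intro pmf_eqI) (auto simp: pmf_pair * indicator_times card_cartesian_product)
qed

text \<open>Each of the two eulerian indicators brings a sum over cuts and a factor
  \<open>2 ^ card (verts G)\<close>, whence \<open>4 ^ card (verts G)\<close>. For fixed
  \<open>S\<close> and \<open>T\<close> the signed summand is a product over single edges, so the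
  sums over \<open>A\<close>, \<open>B\<close> and \<open>C\<close> separate.\<close>

lemma sum_signed_eulerian:
  assumes "finite (verts G)" "finite X" "finite Y" "finite Z" "X \<inter> Z = {}" "Y \<inter> Z = {}"
  shows "(\<Sum>A\<in>Pow X. \<Sum>B\<in>Pow Y. \<Sum>C\<in>Pow Z.
      if eulerian (spanning_subgraph G (A \<union> C)) \<and> eulerian (spanning_subgraph G (C \<union> B))
      then (- 1) ^ (card A + card B + card C) else 0) * 4 ^ card (verts G) =
    (\<Sum>S\<in>Pow (verts G). \<Sum>T\<in>Pow (verts G).
      (\<Prod>e\<in>X. 1 - cut_sign G S e) * (\<Prod>e\<in>Y. 1 - cut_sign G T e) *
      (\<Prod>e\<in>Z. 1 - cut_sign G S e * cut_sign G T e))"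
    (is "?L * _ = ?R")
proof -
  let ?V = "Pow (verts G)"
  let ?s = "cut_sign G"
  let ?x = "\<lambda>S A. \<Prod>e\<in>A. - ?s S e"
  let ?z = "\<lambda>S T C. \<Prod>e\<in>C. - (?s S e * ?s T e)"
  have four: "(4::real) ^ card (verts G) = 2 ^ card (verts G) * 2 ^ card (verts G)"
    by (simp flip: power_mult_distrib)
  have expand: "(if eulerian (spanning_subgraph G (A \<union> C)) \<and> eulerian (spanning_subgraph G (C \<union> B))
      then (- 1) ^ (card A + card B + card C) else 0) * 4 ^ card (verts G) =
      (\<Sum>S\<in>?V. \<Sum>T\<in>?V. ?x S A * ?x T B * ?z S T C)"
    if "A \<subseteq> X" "B \<subseteq> Y" "C \<subseteq> Z" for A B C
  proof -
    have fin: "finite A" "finite B" "finite C" and disj: "A \<inter> C = {}" "C \<inter> B = {}"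
      using that assms by (auto intro: finite_subset)
    have "(if eulerian (spanning_subgraph G (A \<union> C)) \<and> eulerian (spanning_subgraph G (C \<union> B))
        then (- 1) ^ (card A + card B + card C) else 0) * 4 ^ card (verts G) =
        (- 1) ^ (card A + card B + card C) *
        ((\<Sum>S\<in>?V. \<Prod>e\<in>A \<union> C. ?s S e) * (\<Sum>T\<in>?V. \<Prod>e\<in>C \<union> B. ?s T e))"
      using assms(1) by (simp add: sum_cut_sign_prod four)
    also have "\<dots> = (\<Sum>S\<in>?V. \<Sum>T\<in>?V. (- 1) ^ (card A + card B + card C) *
        ((\<Prod>e\<in>A \<union> C. ?s S e) * (\<Prod>e\<in>C \<union> B. ?s T e)))"
      unfolding sum_product by (simp add: sum_distrib_left)
    \<comment> \<open>As \<open>C\<close> is disjoint from \<open>A\<close> and from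
      \<open>B\<close>, both products split. An edge of \<open>C\<close> occurs in both and collects
      \<open>?s S e * ?s T e\<close>; the parity sign supplies one minus per edge.\<close>
    also have "\<dots> = (\<Sum>S\<in>?V. \<Sum>T\<in>?V. ?x S A * ?x T B * ?z S T C)"
      by (simp add: prod.union_disjoint fin disj prod_uminus prod.distrib power_add mult_ac)
    finally show ?thesis .
  qed
  have "?L * 4 ^ card (verts G) =
      (\<Sum>A\<in>Pow X. \<Sum>B\<in>Pow Y. \<Sum>C\<in>Pow Z. \<Sum>S\<in>?V. \<Sum>T\<in>?V. ?x S A * ?x T B * ?z S T C)"
    by (simp add: sum_distrib_right expand)
  \<comment> \<open>The sums over \<open>C\<close>, \<open>B\<close> and \<open>A\<close> move in
    turn past those over the cuts, so that \<open>S\<close> and \<open>T\<close> become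
    fixed.\<close>
  also have "\<dots> = (\<Sum>A\<in>Pow X. \<Sum>B\<in>Pow Y. \<Sum>S\<in>?V. \<Sum>T\<in>?V. \<Sum>C\<in>Pow Z. ?x S A * ?x T B * ?z S T C)"
    by (simp add: sum.swap[of _ _ "Pow Z"])
  also have "\<dots> = (\<Sum>A\<in>Pow X. \<Sum>S\<in>?V. \<Sum>T\<in>?V. \<Sum>B\<in>Pow Y. \<Sum>C\<in>Pow Z. ?x S A * ?x T B * ?z S T C)"
    by (simp add: sum.swap[of _ _ "Pow Y"])
  also have "\<dots> = (\<Sum>S\<in>?V. \<Sum>T\<in>?V. \<Sum>A\<in>Pow X. \<Sum>B\<in>Pow Y. \<Sum>C\<in>Pow Z. ?x S A * ?x T B * ?z S T C)"
    by (simp add: sum.swap[of _ _ "Pow X"])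
  also have "\<dots> = (\<Sum>S\<in>?V. \<Sum>T\<in>?V. (\<Sum>A\<in>Pow X. ?x S A) * (\<Sum>B\<in>Pow Y. ?x T B) * (\<Sum>C\<in>Pow Z. ?z S T C))"
    by (simp only: flip: sum_distrib_left sum_distrib_right)
  also have "\<dots> = ?R"
    using assms by (simp add: sum_Pow_prod)
  finally show ?thesis .
qed

text \<open>The sum over pairs of cuts has no negative term, so nothing cancels, and a single pair
  \<open>S\<close>, \<open>T\<close> witnesses a nonzero bias.\<close>

lemma bias_neq_0_iff:
  assumes "finite_multigraph G" and tri: "tripartition (edges G) X Y Z"
  shows "bias (measure_pmf (random_subsets X Y Z))
      (\<lambda>(A, B, C). even (card A + card B + card C))
      (\<lambda>(A, B, C). eulerian (spanning_subgraph G (A \<union> C)) \<and>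
                   eulerian (spanning_subgraph G (C \<union> B))) \<noteq> 0 \<longleftrightarrow>
    (\<exists>S T. S \<subseteq> verts G \<and> T \<subseteq> verts G \<and>
      (\<forall>e\<in>X. cut_sign G S e = - 1) \<and> (\<forall>e\<in>Y. cut_sign G T e = - 1) \<and>
      (\<forall>e\<in>Z. cut_sign G S e * cut_sign G T e = - 1))"
    (is "bias ?p ?\<Sigma> ?\<Gamma> \<noteq> 0 \<longleftrightarrow> ?cuts")
proof -
  interpret finite_multigraph G
    by fact
  let ?s = "cut_sign G"
  have fin: "finite X" "finite Y" "finite Z" and disj: "X \<inter> Z = {}" "Y \<inter> Z = {}"
    using tri finite_edges by (auto simp: tripartition_def dest: finite_subset[rotated])
  let ?\<Omega> = "Pow X \<times> Pow Y \<times> Pow Z"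
  define h where "h S T = (\<Prod>e\<in>X. 1 - ?s S e) * (\<Prod>e\<in>Y. 1 - ?s T e) *
      (\<Prod>e\<in>Z. 1 - ?s S e * ?s T e)" for S T
  \<comment> \<open>The triple of empty sets shows that \<open>?\<Gamma>\<close> has positive
    probability; otherwise the bias would be 0 by the convention on division.\<close>
  have pos: "card {\<omega>\<in>?\<Omega>. ?\<Gamma> \<omega>} \<noteq> 0"
  proof -
    have "({}, {}, {}) \<in> {\<omega>\<in>?\<Omega>. ?\<Gamma> \<omega>}"
      by (simp add: eulerian_def spanning_subgraph_def degree_def)
    then have "{\<omega>\<in>?\<Omega>. ?\<Gamma> \<omega>} \<noteq> {}"
      by (rule ex_in_conv[THEN iffD1, OF exI])
    moreover have "finite {\<omega>\<in>?\<Omega>. ?\<Gamma> \<omega>}"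
      using fin by simp
    ultimately show ?thesis
      by (simp only: card_0_eq not_False_eq_True)
  qed
  have "bias ?p ?\<Sigma> ?\<Gamma> =
      (\<Sum>\<omega>\<in>?\<Omega>. if ?\<Gamma> \<omega> then (if ?\<Sigma> \<omega> then 1 else - 1) else 0) / card {\<omega>\<in>?\<Omega>. ?\<Gamma> \<omega>}"
    unfolding random_subsets_eq_pmf_of_set[OF fin] by (rule bias_pmf_of_set) (use fin in auto)
  then have "bias ?p ?\<Sigma> ?\<Gamma> \<noteq> 0 \<longleftrightarrow>
      (\<Sum>\<omega>\<in>?\<Omega>. if ?\<Gamma> \<omega> then (if ?\<Sigma> \<omega> then 1 else - 1) else 0) \<noteq> (0::real)"
    using pos by (simp only: divide_eq_0_iff of_nat_eq_0_iff simp_thms)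
  also have "(\<Sum>\<omega>\<in>?\<Omega>. if ?\<Gamma> \<omega> then (if ?\<Sigma> \<omega> then 1 else - 1) else 0) =
    (\<Sum>A\<in>Pow X. \<Sum>B\<in>Pow Y. \<Sum>C\<in>Pow Z.
      if eulerian (spanning_subgraph G (A \<union> C)) \<and> eulerian (spanning_subgraph G (C \<union> B))
      then (- 1) ^ (card A + card B + card C) else (0::real))"
    unfolding sum.cartesian_product
    by (intro sum.cong refl) (simp add: minus_one_power_iff split: prod.splits)
  also have "\<dots> \<noteq> 0 \<longleftrightarrow> (\<Sum>S\<in>Pow (verts G). \<Sum>T\<in>Pow (verts G). h S T) \<noteq> 0"
    unfolding h_def sum_signed_eulerian[OF finite_verts fin disj, symmetric] by simp
  also have "\<dots> \<longleftrightarrow> (\<exists>S T. S \<subseteq> verts G \<and> T \<subseteq> verts G \<and> h S T \<noteq> 0)"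
  proof -
    have le: "?s S e \<le> 1" "?s S e * ?s T e \<le> 1" for S T e
      using cut_sign_cases[of G S e] cut_sign_cases[of G T e] by auto
    have "h S T \<ge> 0" for S T
      unfolding h_def by (intro mult_nonneg_nonneg prod_nonneg) (simp_all add: le)
    then show ?thesis
      using finite_verts by (auto simp: sum_nonneg_eq_0_iff sum_nonneg)
  qed
  also have "\<dots> \<longleftrightarrow> ?cuts"
  proof -
    \<comment> \<open>The signs being 1 or -1, every factor of \<open>h S T\<close> is 0 or
      2.\<close>
    have "1 - ?s S e = 0 \<longleftrightarrow> ?s S e \<noteq> - 1" "1 - ?s S e * ?s T e = 0 \<longleftrightarrow> ?s S e * ?s T e \<noteq> - 1" for S T e
      using cut_sign_cases[of G S e] cut_sign_cases[of G T e] by auto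
    then show ?thesis
      using fin by (simp add: h_def prod_zero_iff)
  qed
  finally show ?thesis .
qed

section \<open>Proper 4-colourings as pairs of cuts\<close>

lemma num_colourings_neq_0_iff:
  assumes "finite (verts G)"
  shows "num_colourings G q \<noteq> 0 \<longleftrightarrow> (\<exists>f \<in> verts G \<rightarrow>\<^sub>E {..<q}. proper_colouring G f)"
proof -
  have "finite {f \<in> verts G \<rightarrow>\<^sub>E {..<q}. proper_colouring G f}"
    using assms by (simp add: finite_PiE)
  then show ?thesis
    by (auto simp: num_colourings_def)
qed

text \<open>A colour below 4 is a pair of bits, and each bit is the indicator of a vertex set. The
  ends of an edge differ in colour iff some bit separates them, that is, iff one of the two cuts
  contains the edge. A loop makes both sides fail.\<close>

lemma colourable_4_iff_cuts_cover:
  assumes "finite_multigraph G"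
  shows "num_colourings G 4 \<noteq> 0 \<longleftrightarrow>
    (\<exists>S T. S \<subseteq> verts G \<and> T \<subseteq> verts G \<and>
      (\<forall>e\<in>edges G. cut_sign G S e = - 1 \<or> cut_sign G T e = - 1))"
proof -
  interpret finite_multigraph G
    by fact
  show ?thesis
    unfolding num_colourings_neq_0_iff[OF finite_verts]
  proof safe
    fix f assume f: "f \<in> verts G \<rightarrow>\<^sub>E {..<4}" "proper_colouring G f"
    \<comment> \<open>The low bit of the colour gives \<open>S\<close>, the high bit gives
      \<open>T\<close>.\<close>
    define S where "S = {v \<in> verts G. odd (f v)}"
    define T where "T = {v \<in> verts G. odd (f v div 2)}"
    have fin: "finite S" "finite T"
      using finite_verts by (simp_all add: S_def T_def)
    have "cut_sign G S e = - 1 \<or> cut_sign G T e = - 1" if e: "e \<in> edges G" for e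
    proof -
      obtain u v where uv: "ends G e = {#u, v#}"
        using size_ends[OF e] by (metis numeral_2_eq_2 size_eq_Suc_imp_eq_union size_eq_0_iff_empty
            add_mset_add_single size_add_mset diff_Suc_1)
      then have V: "u \<in> verts G" "v \<in> verts G"
        using ends_subset_verts[OF e] by auto
      have "f u \<noteq> f v"
        using f(2) e uv by (auto simp: proper_colouring_def)
      moreover have "f u < 4" "f v < 4"
        using f(1) V by (auto dest: PiE_mem)
      ultimately have "odd (f u) \<noteq> odd (f v) \<or> odd (f u div 2) \<noteq> odd (f v div 2)"
        by presburger
      then show ?thesis
        unfolding cut_sign_eq_minus_one_iff[OF fin(1) uv] cut_sign_eq_minus_one_iff[OF fin(2) uv]
        using V by (auto simp: S_def T_def)
    qed
    moreover have "S \<subseteq> verts G" "T \<subseteq> verts G"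
      by (auto simp: S_def T_def)
    ultimately show "\<exists>S T. S \<subseteq> verts G \<and> T \<subseteq> verts G \<and>
      (\<forall>e\<in>edges G. cut_sign G S e = - 1 \<or> cut_sign G T e = - 1)"
      by blast
  next
    fix S T
    assume ST: "S \<subseteq> verts G" "T \<subseteq> verts G"
      and cover: "\<forall>e\<in>edges G. cut_sign G S e = - 1 \<or> cut_sign G T e = - 1"
    have fin: "finite S" "finite T"
      using ST finite_verts finite_subset by auto
    \<comment> \<open>This inverts the encoding by bits; \<open>restrict\<close> makes
      \<open>f\<close> undefined off the vertices, as the extensional function space
      demands.\<close>
    define f where "f = restrict (\<lambda>v. of_bool (v \<in> S) + 2 * of_bool (v \<in> T) :: nat) (verts G)"
    have "proper_colouring G f"
      unfolding proper_colouring_def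
    proof (intro ballI allI impI)
      fix e u v assume e: "e \<in> edges G" and uv: "ends G e = {#u, v#}"
      have "u \<in> verts G" "v \<in> verts G"
        using ends_subset_verts[OF e] uv by auto
      moreover have "(u \<in> S) \<noteq> (v \<in> S) \<or> (u \<in> T) \<noteq> (v \<in> T)"
        using cover e by (auto simp: cut_sign_eq_minus_one_iff[OF fin(1) uv]
            cut_sign_eq_minus_one_iff[OF fin(2) uv])
      ultimately show "f u \<noteq> f v"
        by (auto simp: f_def of_bool_def)
    qed
    moreover have "f \<in> verts G \<rightarrow>\<^sub>E {..<4}"
      by (auto simp: f_def)
    ultimately show "\<exists>f \<in> verts G \<rightarrow>\<^sub>E {..<4}. proper_colouring G f"
      by blast
  qed
qed

section \<open>Passing between tripartitions and covering cuts\<close>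

theorem theorem3p5:
  fixes G :: "('v, 'e) multigraph"
  assumes "finite_multigraph G"
  shows "(\<exists>X Y Z. tripartition (edges G) X Y Z \<and>
            bias (measure_pmf (random_subsets X Y Z))
              (\<lambda>(A, B, C). even (card A + card B + card C))
              (\<lambda>(A, B, C). eulerian (spanning_subgraph G (A \<union> C)) \<and>
                           eulerian (spanning_subgraph G (C \<union> B))) \<noteq> 0)
         \<longleftrightarrow> num_colourings G 4 \<noteq> 0"
    (is "(\<exists>X Y Z. _ \<and> ?b X Y Z \<noteq> 0) \<longleftrightarrow> _")
  unfolding colourable_4_iff_cuts_cover[OF assms]
proof safe
  fix X Y Z assume tri: "tripartition (edges G) X Y Z" and "?b X Y Z \<noteq> 0"
  then obtain S T where ST: "S \<subseteq> verts G" "T \<subseteq> verts G"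
      "\<forall>e\<in>X. cut_sign G S e = - 1" "\<forall>e\<in>Y. cut_sign G T e = - 1"
      "\<forall>e\<in>Z. cut_sign G S e * cut_sign G T e = - 1"
    using bias_neq_0_iff[OF assms tri] by metis
  have "cut_sign G S e = - 1 \<or> cut_sign G T e = - 1" if "e \<in> edges G" for e
  proof -
    have "e \<in> X \<or> e \<in> Y \<or> e \<in> Z"
      using that tri by (auto simp: tripartition_def)
    \<comment> \<open>On \<open>Z\<close> the two signs multiply to -1, so one of them is
      -1.\<close>
    then show ?thesis
      using ST(3-5) cut_sign_cases[of G S e] by (metis mult_1)
  qed
  with ST show "\<exists>S T. S \<subseteq> verts G \<and> T \<subseteq> verts G \<and>
      (\<forall>e\<in>edges G. cut_sign G S e = - 1 \<or> cut_sign G T e = - 1)"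
    by blast
next
  fix S T
  assume ST: "S \<subseteq> verts G" "T \<subseteq> verts G"
    and cover: "\<forall>e\<in>edges G. cut_sign G S e = - 1 \<or> cut_sign G T e = - 1"
  \<comment> \<open>The edges cut by \<open>S\<close> form \<open>X\<close>; the remaining ones are
    cut by \<open>T\<close> because the cuts cover, and the condition on the empty third part is
    vacuous.\<close>
  define X where "X = {e \<in> edges G. cut_sign G S e = - 1}"
  have tri: "tripartition (edges G) X (edges G - X) {}"
    by (auto simp: tripartition_def X_def)
  moreover have "?b X (edges G - X) {} \<noteq> 0"
    unfolding bias_neq_0_iff[OF assms tri] using ST cover
    by (intro exI[of _ S] exI[of _ T]) (auto simp: X_def)
  ultimately show "\<exists>X Y Z. tripartition (edges G) X Y Z \<and> ?b X Y Z \<noteq> 0"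
    by (intro exI conjI)
qed

end
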